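(* Let $G$ and $H$ be finite, simple, connected graphs, each with at least two vertices. Then $2\le h(G\boxtimes H)\le h(G)\,h(H)$. Furthermore, both bounds are sharp, i.e. each of the two inequalities holds with equality for some such pair of graphs $G,H$.
   Context: For a connected graph $G$, the closed interval $I[x,y]$ consists of $x$, $y$ and all vertices on some shortest $x$–$y$ path; for $S\subseteq V(G)$, $I[S]=\bigcup_{u,v\in S}I[u,v]$. Set $I^0[S]=S$ and $I^i[S]=I[I^{i-1}[S]]$ for $i\ge1$. A set is convex if $I[S]=S$; the convex hull $CH(S)$ is the smallest convex set containing $S$ (equivalently $CH(S)=I^r[S]$ for some $r\ge 0$). $S$ is a hull set if $CH(S)=V(G)$; the hull number $h(G)$ is the minimum cardinality of a hull set. The strong product $G\boxtimes H$ has vertex set $V(G)\times V(H)$, with $(g,h)$ and $(g',h')$ adjacent whenever ($g=g'$ and $hh'\in E(H)$), or ($h=h'$ and $gg'\in E(G)$), or ($gg'\in E(G)$ and $hh'\in E(H)$). *)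

theory Defs
  imports "Graph_Theory.Vertex_Walk" "Graph_Theory.Digraph_Component"
begin

text \<open>
  A finite simple undirected graph is a \<^const>\<open>pair_graph\<close>: a finite vertex set together with
  an irreflexive symmetric set of ordered pairs, the edge \<open>uv\<close> being represented by both
  \<open>(u, v)\<close> and \<open>(v, u)\<close>.
\<close>

definition nontrivial_connected_graph :: "'a pair_pre_digraph \<Rightarrow> bool" where
  "nontrivial_connected_graph G \<longleftrightarrow>
     pair_graph G \<and> Digraph_Component.connected (with_proj G) \<and> 2 \<le> card (pverts G)"

definition path_between :: "'a pair_pre_digraph \<Rightarrow> 'a \<Rightarrow> 'a list \<Rightarrow> 'a \<Rightarrow> bool" where
  "path_between G x p y \<longleftrightarrow> vpath p (with_proj G) \<and> hd p = x \<and> last p = y"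

definition shortest_path :: "'a pair_pre_digraph \<Rightarrow> 'a \<Rightarrow> 'a list \<Rightarrow> 'a \<Rightarrow> bool" where
  "shortest_path G x p y \<longleftrightarrow>
     path_between G x p y \<and> (\<forall>q. path_between G x q y \<longrightarrow> vwalk_length p \<le> vwalk_length q)"

definition closed_interval :: "'a pair_pre_digraph \<Rightarrow> 'a \<Rightarrow> 'a \<Rightarrow> 'a set" where
  "closed_interval G x y = {x, y} \<union> {w. \<exists>p. shortest_path G x p y \<and> w \<in> set p}"

definition interval_closure :: "'a pair_pre_digraph \<Rightarrow> 'a set \<Rightarrow> 'a set" where
  "interval_closure G S = (\<Union>u\<in>S. \<Union>v\<in>S. closed_interval G u v)"

definition geodesically_convex :: "'a pair_pre_digraph \<Rightarrow> 'a set \<Rightarrow> bool" where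
  "geodesically_convex G S \<longleftrightarrow> S \<subseteq> pverts G \<and> interval_closure G S = S"

text \<open>
  The operator \<open>hull\<close> intersects all convex sets containing \<open>S\<close>; since convex sets are
  closed under intersection, for \<open>S \<subseteq> pverts G\<close> this is the smallest one.
\<close>

definition convex_hull :: "'a pair_pre_digraph \<Rightarrow> 'a set \<Rightarrow> 'a set" where
  "convex_hull G S = geodesically_convex G hull S"

definition hull_set :: "'a pair_pre_digraph \<Rightarrow> 'a set \<Rightarrow> bool" where
  "hull_set G S \<longleftrightarrow> S \<subseteq> pverts G \<and> convex_hull G S = pverts G"

definition hull_number :: "'a pair_pre_digraph \<Rightarrow> nat" where
  "hull_number G = (LEAST k. \<exists>S. hull_set G S \<and> card S = k)"

definition strong_product ::
  "'a pair_pre_digraph \<Rightarrow> 'b pair_pre_digraph \<Rightarrow> ('a \<times> 'b) pair_pre_digraph"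
  (infixl \<open>\<boxtimes>\<close> 70) where
  "G \<boxtimes> H =
     \<lparr> pverts = pverts G \<times> pverts H,
       parcs = {((g, h), (g', h')) | g h g' h'.
         g \<in> pverts G \<and> g = g' \<and> (h, h') \<in> parcs H \<or>
         h \<in> pverts H \<and> h = h' \<and> (g, g') \<in> parcs G \<or>
         (g, g') \<in> parcs G \<and> (h, h') \<in> parcs H} \<rparr>"

end

theory Submission
  imports Defs
begin

text \<open>
  The slices \<open>G \<times> {h}\<close> and \<open>{g} \<times> H\<close> are retracts of \<open>G \<boxtimes> H\<close> under the non-expansive
  coordinate projections, so shortest paths of a factor stay shortest in the product. Hence a convex
  set containing \<open>S \<times> T\<close>, with \<open>S\<close> and \<open>T\<close> hull sets, first contains \<open>V(G) \<times> T\<close> and then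
  everything. A hull set has at least two elements since \<open>{}\<close> and singletons are convex. The upper
  bound is attained by \<open>K\<^sub>2 \<boxtimes> K\<^sub>2 = K\<^sub>4\<close>, in which every set is convex, and the lower bound by
  \<open>C\<^sub>4 \<boxtimes> K\<^sub>2\<close>, where two vertices over opposite corners of \<open>C\<^sub>4\<close> have all four vertices over the
  other two corners as common neighbours, and vice versa.
\<close>

section \<open>Walks and shortest paths\<close>

lemma vwalk_with_proj_Cons:
  "vwalk (u # p) (with_proj G) \<longleftrightarrow>
     u \<in> pverts G \<and> (p = [] \<or> (u, hd p) \<in> parcs G \<and> vwalk p (with_proj G))"
  by (cases p) (auto simp: vwalk_def)

lemma length_vwalk_to_vpath: "length (vwalk_to_vpath p) \<le> length p"
proof (induct p rule: vwalk_to_vpath_induct3)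
  case (in_set x xs)
  then show ?case
    using length_dropWhile_le[of "\<lambda>y. y \<noteq> x" xs] by simp
qed auto

text \<open>A walk shortens to a path via \<open>vwalk_to_vpath\<close>. Competitors of a shortest
  path may therefore repeat vertices, which images under a non-injective map do.\<close>

lemma shortest_path_le_vwalk:
  assumes "shortest_path G x p y" "vwalk q (with_proj G)" "hd q = x" "last q = y"
  shows "length p \<le> length q"
proof -
  have "path_between G x (vwalk_to_vpath q) y"
    using assms unfolding path_between_def
    by (simp add: vwalk_to_vpath_vpath vwalk_to_vpath_hd vwalk_to_vpath_last)
  \<comment> \<open>\<open>vwalk_length\<close> is \<open>length - 1\<close> with truncated
    subtraction, so an inequality of vertex counts also takes \<open>q\<close> nonempty.\<close>
  then have "length p - 1 \<le> length (vwalk_to_vpath q) - 1"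
    using assms(1) by (simp add: shortest_path_def)
  moreover have "q \<noteq> []" using assms(2) by auto
  ultimately show ?thesis
    using length_vwalk_to_vpath[of q] by (cases q) auto
qed

section \<open>Convex sets and hull sets\<close>

text \<open>Intervals contain their endpoints, so \<open>S\<close> always lies in its closure and
  only the inner vertices of shortest paths can break convexity.\<close>

lemma geodesically_convexI:
  assumes "S \<subseteq> pverts G"
    and "\<And>x p y. \<lbrakk>x \<in> S; y \<in> S; shortest_path G x p y\<rbrakk> \<Longrightarrow> set p \<subseteq> S"
  shows "geodesically_convex G S"
  using assms by (fastforce simp: geodesically_convex_def interval_closure_def closed_interval_def)

lemma geodesically_convexD:
  assumes "geodesically_convex G S" "x \<in> S" "y \<in> S" "shortest_path G x p y"
  shows "set p \<subseteq> S"
proof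
  fix w assume "w \<in> set p"
  then have "w \<in> interval_closure G S"
    using assms(2-4) by (auto simp: interval_closure_def closed_interval_def)
  then show "w \<in> S" using assms(1) by (simp add: geodesically_convex_def)
qed

lemma shortest_path_subset_pverts: "shortest_path G x p y \<Longrightarrow> set p \<subseteq> pverts G"
  by (auto simp: shortest_path_def path_between_def vpath_def vwalk_def)

lemma geodesically_convex_pverts: "geodesically_convex G (pverts G)"
  by (intro geodesically_convexI shortest_path_subset_pverts) auto

text \<open>The whole vertex set is convex, so the hull of \<open>S\<close> never leaves it and one
  inclusion decides the matter.\<close>

lemma hull_set_iff:
  "hull_set G S \<longleftrightarrow>
     S \<subseteq> pverts G \<and> (\<forall>C. geodesically_convex G C \<and> S \<subseteq> C \<longrightarrow> pverts G \<subseteq> C)"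
  unfolding hull_set_def convex_hull_def hull_def
  using geodesically_convex_pverts[of G] by blast

lemma hull_set_pverts: "hull_set G (pverts G)"
  by (auto simp: hull_set_iff)

lemma hull_number_attained: "\<exists>S. hull_set G S \<and> card S = hull_number G"
  unfolding hull_number_def by (rule LeastI_ex) (use hull_set_pverts in blast)

lemma hull_number_le: "hull_set G S \<Longrightarrow> hull_number G \<le> card S"
  unfolding hull_number_def by (rule Least_le) blast

lemma hull_set_convex: "\<lbrakk>hull_set G S; geodesically_convex G S\<rbrakk> \<Longrightarrow> S = pverts G"
  unfolding hull_set_iff by blast

lemma geodesically_convex_empty: "geodesically_convex G {}"
  by (rule geodesically_convexI) auto

lemma geodesically_convex_singleton:
  assumes "x \<in> pverts G"
  shows "geodesically_convex G {x}"
proof (rule geodesically_convexI)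
  fix y p z assume "y \<in> {x}" "z \<in> {x}" and p: "shortest_path G y p z"
  then have "length p \<le> length [x]"
    using assms by (intro shortest_path_le_vwalk[OF p]) (auto simp: vwalk_def)
  moreover have "p \<noteq> []" "hd p = y"
    using p by (auto simp: shortest_path_def path_between_def)
  ultimately show "set p \<subseteq> {x}"
    using \<open>y \<in> {x}\<close> by (cases p) auto
qed (use assms in auto)

lemma two_le_hull_number:
  assumes fin: "finite (pverts G)" and two: "2 \<le> card (pverts G)"
  shows "2 \<le> hull_number G"
proof (rule ccontr)
  assume small: "\<not> 2 \<le> hull_number G"
  obtain S where S: "hull_set G S" "card S = hull_number G"
    using hull_number_attained by blast
  have sub: "S \<subseteq> pverts G" using S(1) by (simp add: hull_set_def)
  then have "finite S" using fin finite_subset by blast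
  then have "S = {} \<or> (\<exists>x. S = {x})"
    using small S(2) by (metis One_nat_def card_0_eq card_1_singletonE less_2_cases not_le)
  then have "geodesically_convex G S"
    using sub by (metis geodesically_convex_empty geodesically_convex_singleton insert_subset)
  then have "S = pverts G" using S(1) by (intro hull_set_convex)
  then show False using small two S(2) by simp
qed

section \<open>Retracts preserve shortest paths\<close>

text \<open>Apply \<open>r\<close> along the walk and drop a vertex whenever an edge collapses: what
  remains is a walk in \<open>G\<close> that has not grown.\<close>

lemma vwalk_nonexpansive_image:
  assumes "vwalk q (with_proj K)"
    and "r ` pverts K \<subseteq> pverts G"
    and "\<And>a b. (a, b) \<in> parcs K \<Longrightarrow> r a = r b \<or> (r a, r b) \<in> parcs G"
  shows "\<exists>q'. vwalk q' (with_proj G) \<and> hd q' = r (hd q) \<and> last q' = r (last q) \<and>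
           length q' \<le> length q"
  using assms(1)
proof (induction q rule: list.induct)
  case Nil
  then show ?case by auto
next
  case (Cons a q)
  show ?case
  proof (cases "q = []")
    case True
    then show ?thesis
      using Cons.prems assms(2)
      by (intro exI[of _ "[r a]"]) (auto simp: vwalk_with_proj_Cons)
  next
    case False
    then have a: "a \<in> pverts K" "(a, hd q) \<in> parcs K" "vwalk q (with_proj K)"
      using Cons.prems by (auto simp: vwalk_with_proj_Cons)
    then obtain q' where q': "vwalk q' (with_proj G)" "hd q' = r (hd q)"
      "last q' = r (last q)" "length q' \<le> length q"
      using Cons.IH by blast
    then have ne: "q' \<noteq> []" by auto
    from assms(3)[OF a(2)] show ?thesis
    proof
      \<comment> \<open>The edge collapses: \<open>q'\<close> already starts at
        \<open>r a\<close>.\<close>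
      assume "r a = r (hd q)"
      then show ?thesis using q' False by (intro exI[of _ q']) auto
    next
      assume "(r a, r (hd q)) \<in> parcs G"
      then have "vwalk (r a # q') (with_proj G)"
        using q' a(1) assms(2) by (auto simp: vwalk_with_proj_Cons)
      then show ?thesis using q' False ne by (intro exI[of _ "r a # q'"]) auto
    qed
  qed
qed

lemma vwalk_map:
  assumes "vwalk p (with_proj G)"
    and "f ` pverts G \<subseteq> pverts K"
    and "\<And>a b. (a, b) \<in> parcs G \<Longrightarrow> (f a, f b) \<in> parcs K"
  shows "vwalk (map f p) (with_proj K)"
  using assms(1)
proof (induction p rule: list.induct)
  case (Cons a p)
  then show ?case
    using assms(2,3) by (cases p) (auto simp: vwalk_with_proj_Cons)
qed auto

text \<open>\<open>f\<close> embeds \<open>G\<close> into \<open>K\<close>; its left inverse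
  \<open>r\<close> maps each edge to an edge or to a single vertex. Together they make the copy of
  \<open>G\<close> isometric in \<open>K\<close>.\<close>

locale graph_retract =
  fixes G :: "'a pair_pre_digraph" and K :: "'b pair_pre_digraph"
    and f :: "'a \<Rightarrow> 'b" and r :: "'b \<Rightarrow> 'a"
  assumes section_verts: "f ` pverts G \<subseteq> pverts K"
    and section_arcs: "(a, b) \<in> parcs G \<Longrightarrow> (f a, f b) \<in> parcs K"
    and retraction_verts: "r ` pverts K \<subseteq> pverts G"
    and retraction_arcs: "(c, d) \<in> parcs K \<Longrightarrow> r c = r d \<or> (r c, r d) \<in> parcs G"
    and retraction_section [simp]: "r (f a) = a"
begin

text \<open>A detour through \<open>K\<close> outside the copy cannot be a shortcut:
  \<open>r\<close> projects it to a walk in \<open>G\<close> that is no longer.\<close>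

lemma shortest_path_map:
  assumes p: "shortest_path G x p y"
  shows "shortest_path K (f x) (map f p) (f y)"
proof -
  have path: "vwalk p (with_proj G)" "distinct p" "hd p = x" "last p = y" "p \<noteq> []"
    using p by (auto simp: shortest_path_def path_between_def)
  have "inj f" by (rule inj_on_inverseI[of _ r]) simp
  then have "path_between K (f x) (map f p) (f y)"
    using path vwalk_map[OF path(1) section_verts section_arcs]
    by (auto simp: path_between_def vpath_def hd_map last_map distinct_map inj_on_def)
  moreover have "length p \<le> length q" if q: "path_between K (f x) q (f y)" for q
  proof -
    have "vwalk q (with_proj K)" "hd q = f x" "last q = f y"
      using q by (auto simp: path_between_def)
    then obtain q' where "vwalk q' (with_proj G)" "hd q' = x" "last q' = y"
      "length q' \<le> length q"
      using vwalk_nonexpansive_image[OF _ retraction_verts retraction_arcs, of q] by auto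
    then show ?thesis using shortest_path_le_vwalk[OF p, of q'] by simp
  qed
  ultimately show ?thesis by (auto simp: shortest_path_def intro: diff_le_mono)
qed

lemma geodesically_convex_vimage:
  assumes "geodesically_convex K C"
  shows "geodesically_convex G {a \<in> pverts G. f a \<in> C}"
proof (rule geodesically_convexI)
  fix x p y
  assume "x \<in> {a \<in> pverts G. f a \<in> C}" "y \<in> {a \<in> pverts G. f a \<in> C}"
    and p: "shortest_path G x p y"
  then have "set (map f p) \<subseteq> C"
    by (intro geodesically_convexD[OF assms _ _ shortest_path_map[OF p]]) auto
  then show "set p \<subseteq> {a \<in> pverts G. f a \<in> C}"
    using shortest_path_subset_pverts[OF p] by auto
qed auto

text \<open>The preimage of \<open>C\<close> under \<open>f\<close> is convex in \<open>G\<close>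
  and contains the hull set \<open>S\<close>, so it is all of \<open>G\<close>.\<close>

lemma section_hull_set:
  assumes "geodesically_convex K C" "hull_set G S" "f ` S \<subseteq> C"
  shows "f ` pverts G \<subseteq> C"
  using geodesically_convex_vimage[OF assms(1)] assms(2,3) unfolding hull_set_iff by blast

end

section \<open>Bounds for the strong product\<close>

lemma pverts_strong_product [simp]: "pverts (G \<boxtimes> H) = pverts G \<times> pverts H"
  by (simp add: strong_product_def)

lemma parcs_strong_product_iff:
  "((g, h), (g', h')) \<in> parcs (G \<boxtimes> H) \<longleftrightarrow>
     g \<in> pverts G \<and> g = g' \<and> (h, h') \<in> parcs H \<or>
     h \<in> pverts H \<and> h = h' \<and> (g, g') \<in> parcs G \<or>
     (g, g') \<in> parcs G \<and> (h, h') \<in> parcs H"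
  by (simp add: strong_product_def)

lemma graph_retract_fst:
  assumes "h \<in> pverts H"
  shows "graph_retract G (G \<boxtimes> H) (\<lambda>g. (g, h)) fst"
  using assms by unfold_locales (auto simp: parcs_strong_product_iff)

lemma graph_retract_snd:
  assumes "g \<in> pverts G"
  shows "graph_retract H (G \<boxtimes> H) (\<lambda>h. (g, h)) snd"
  using assms by unfold_locales (auto simp: parcs_strong_product_iff)

lemma hull_set_strong_product:
  assumes S: "hull_set G S" and T: "hull_set H T"
  shows "hull_set (G \<boxtimes> H) (S \<times> T)"
  unfolding hull_set_iff
proof (intro conjI allI impI)
  have subT: "T \<subseteq> pverts H" using T by (simp add: hull_set_def)
  then show "S \<times> T \<subseteq> pverts (G \<boxtimes> H)" using S by (auto simp: hull_set_def)
  fix C assume C: "geodesically_convex (G \<boxtimes> H) C \<and> S \<times> T \<subseteq> C"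
  \<comment> \<open>The slice over \<open>t\<close> meets \<open>C\<close> at least in
    \<open>S \<times> {t}\<close>, a copy of a hull set of \<open>G\<close>.\<close>
  have row: "(g, t) \<in> C" if "g \<in> pverts G" "t \<in> T" for g t
    using graph_retract.section_hull_set[OF graph_retract_fst, of t H G C S] that C S subT by blast
  \<comment> \<open>By \<open>row\<close>, each slice over \<open>g\<close> now has its copy of
    \<open>T\<close> inside \<open>C\<close>.\<close>
  have "(g, h) \<in> C" if "g \<in> pverts G" "h \<in> pverts H" for g h
    using graph_retract.section_hull_set[OF graph_retract_snd, of g G H C T] that C T row by blast
  then show "pverts (G \<boxtimes> H) \<subseteq> C" by auto
qed

lemma hull_number_strong_product_le:
  "hull_number (G \<boxtimes> H) \<le> hull_number G * hull_number H"
proof -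
  obtain S T where "hull_set G S" "card S = hull_number G" "hull_set H T" "card T = hull_number H"
    using hull_number_attained by metis
  then show ?thesis
    using hull_number_le[OF hull_set_strong_product] by (metis card_cartesian_product)
qed

lemma two_le_hull_number_strong_product:
  assumes "nontrivial_connected_graph G" "nontrivial_connected_graph H"
  shows "2 \<le> hull_number (G \<boxtimes> H)"
proof (rule two_le_hull_number)
  interpret G: pair_graph G using assms(1) by (simp add: nontrivial_connected_graph_def)
  interpret H: pair_graph H using assms(2) by (simp add: nontrivial_connected_graph_def)
  show "finite (pverts (G \<boxtimes> H))"
    using G.pair_finite_verts H.pair_finite_verts by simp
  have "2 * 2 \<le> card (pverts G) * card (pverts H)"
    using assms by (intro mult_le_mono) (simp_all add: nontrivial_connected_graph_def)
  then show "2 \<le> card (pverts (G \<boxtimes> H))" by (simp add: card_cartesian_product)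
qed

section \<open>Sharpness of the bounds\<close>

text \<open>Shortest paths have at most two vertices, their endpoints. Hence every vertex set is
  convex, and only the full one is a hull set.\<close>

lemma hull_number_complete:
  assumes "\<And>u v. \<lbrakk>u \<in> pverts G; v \<in> pverts G; u \<noteq> v\<rbrakk> \<Longrightarrow> (u, v) \<in> parcs G"
  shows "hull_number G = card (pverts G)"
proof -
  have "geodesically_convex G S" if S: "S \<subseteq> pverts G" for S
  proof (rule geodesically_convexI[OF S])
    fix x p y assume xy: "x \<in> S" "y \<in> S" and p: "shortest_path G x p y"
    have p': "hd p = x" "last p = y" "p \<noteq> []"
      using p by (auto simp: shortest_path_def path_between_def)
    have "length p \<le> 2"
    proof (cases "x = y")
      case True
      then have "length p \<le> length [x]"
        using xy S by (intro shortest_path_le_vwalk[OF p]) (auto simp: vwalk_with_proj_Cons)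
      then show ?thesis by simp
    next
      case False
      then have "length p \<le> length [x, y]"
        using xy S assms
        by (intro shortest_path_le_vwalk[OF p]) (auto simp: vwalk_with_proj_Cons)
      then show ?thesis by simp
    qed
    then show "set p \<subseteq> S"
      using p' xy by (cases p rule: vwalk_arcs.cases) auto
  qed
  then have "S = pverts G" if "hull_set G S" for S
    using hull_set_convex that by (auto simp: hull_set_def)
  then show ?thesis using hull_number_attained[of G] by auto
qed

lemma common_neighbour_in_convex:
  assumes "geodesically_convex G C" "x \<in> C" "y \<in> C"
    and xz: "(x, z) \<in> parcs G" and zy: "(z, y) \<in> parcs G"
    and "z \<in> pverts G" "x \<noteq> z" "z \<noteq> y" "x \<noteq> y" "(x, y) \<notin> parcs G"
  shows "z \<in> C"
proof -
  have "x \<in> pverts G" "y \<in> pverts G"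
    using assms(1-3) by (auto simp: geodesically_convex_def)
  then have "path_between G x [x, z, y] y"
    using assms by (auto simp: path_between_def vpath_def vwalk_with_proj_Cons)
  \<comment> \<open>One vertex would give \<open>x = y\<close>, and two would make \<open>x\<close>
    and \<open>y\<close> adjacent.\<close>
  moreover have "3 \<le> length q" if "path_between G x q y" for q
    using that assms(9,10)
    by (cases q rule: vwalk_arcs.cases)
      (auto simp: path_between_def vpath_def vwalk_with_proj_Cons Suc_le_eq split: if_splits)
  ultimately have "shortest_path G x [x, z, y] y"
    by (fastforce simp: shortest_path_def)
  from geodesically_convexD[OF assms(1-3) this] show ?thesis by simp
qed

text \<open>Diameter at most two covers both example graphs. Connectedness is strong connectedness
  of the symmetric closure, to which reachability in \<open>G\<close> carries over.\<close>

lemma connected_with_projI: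
  assumes "pair_graph G" "pverts G \<noteq> {}"
    and "\<And>u v. \<lbrakk>u \<in> pverts G; v \<in> pverts G; u \<noteq> v\<rbrakk> \<Longrightarrow>
           (u, v) \<in> parcs G \<or> (\<exists>w. (u, w) \<in> parcs G \<and> (w, v) \<in> parcs G)"
  shows "Digraph_Component.connected (with_proj G)"
proof -
  interpret pair_graph G by fact
  have "u \<rightarrow>\<^sup>*\<^bsub>with_proj G\<^esub> v" if "u \<in> pverts G" "v \<in> pverts G" for u v
    using assms(3)[OF that] that
    by (cases "u = v") (auto intro: reachable_adj_trans)
  then show ?thesis
    using assms(2) reachable_mk_symmetricI
    by (auto simp: Digraph_Component.connected_def strongly_connected_def)
qed

definition edge_graph :: "nat pair_pre_digraph" where
  "edge_graph = \<lparr> pverts = {0, 1}, parcs = {(0, 1), (1, 0)} \<rparr>"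

text \<open>The 4-cycle, with opposite corners 0, 2 and 1, 3.\<close>

definition square_graph :: "nat pair_pre_digraph" where
  "square_graph = \<lparr> pverts = {0, 1, 2, 3},
     parcs = {(0, 1), (1, 0), (1, 2), (2, 1), (2, 3), (3, 2), (3, 0), (0, 3)} \<rparr>"

lemma nontrivial_connected_edge_graph: "nontrivial_connected_graph edge_graph"
proof -
  have "pair_graph edge_graph"
    by unfold_locales (auto simp: edge_graph_def symmetric_def sym_def)
  moreover from this have "Digraph_Component.connected (with_proj edge_graph)"
    by (rule connected_with_projI) (auto simp: edge_graph_def)
  ultimately show ?thesis by (simp add: nontrivial_connected_graph_def edge_graph_def)
qed

lemma nontrivial_connected_square_graph: "nontrivial_connected_graph square_graph"
proof -
  have "pair_graph square_graph"
    by unfold_locales (auto simp: square_graph_def symmetric_def sym_def)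
  moreover from this have "Digraph_Component.connected (with_proj square_graph)"
    by (rule connected_with_projI) (auto simp: square_graph_def)
  ultimately show ?thesis by (simp add: nontrivial_connected_graph_def square_graph_def)
qed

lemma hull_set_square_strong_edge: "hull_set (square_graph \<boxtimes> edge_graph) {(0, 0), (2, 0)}"
  unfolding hull_set_iff
proof (intro conjI allI impI)
  let ?K = "square_graph \<boxtimes> edge_graph"
  show "{(0, 0), (2, 0)} \<subseteq> pverts ?K"
    by (simp add: square_graph_def edge_graph_def)
  fix C assume C: "geodesically_convex ?K C \<and> {(0, 0), (2, 0)} \<subseteq> C"
  note step = common_neighbour_in_convex[OF conjunct1[OF C]]
  \<comment> \<open>Corners 1 and 3 are adjacent to both 0 and 2, and \<open>b\<close> is equal or
    adjacent to 0, so \<open>(a, b)\<close> is a common neighbour of the two starting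
    vertices.\<close>
  have odd: "(a, b) \<in> C" if "a \<in> {1, 3}" "b \<in> {0, 1}" for a b
    using that C
    by - (rule step[of "(0, 0)" "(2, 0)"],
        auto simp: parcs_strong_product_iff square_graph_def edge_graph_def)
  \<comment> \<open>The same argument from \<open>(1, 0)\<close> and \<open>(3, 0)\<close>, now
    known to be in \<open>C\<close>, reaches the missing \<open>(0, 1)\<close> and
    \<open>(2, 1)\<close>.\<close>
  have "(a, b) \<in> C" if "a \<in> {0, 2}" "b \<in> {0, 1}" for a b
    using that odd
    by - (rule step[of "(1, 0)" "(3, 0)"],
        auto simp: parcs_strong_product_iff square_graph_def edge_graph_def)
  with odd show "pverts ?K \<subseteq> C" by (auto simp: square_graph_def edge_graph_def)
qed

lemma hull_number_square_strong_edge: "hull_number (square_graph \<boxtimes> edge_graph) = 2"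
proof (rule antisym)
  show "hull_number (square_graph \<boxtimes> edge_graph) \<le> 2"
    using hull_number_le[OF hull_set_square_strong_edge] by simp
  show "2 \<le> hull_number (square_graph \<boxtimes> edge_graph)"
    by (intro two_le_hull_number_strong_product nontrivial_connected_square_graph
        nontrivial_connected_edge_graph)
qed

text \<open>Factors and product are complete, so the hull numbers are vertex counts, which
  multiply.\<close>

lemma hull_number_edge_strong_edge:
  "hull_number (edge_graph \<boxtimes> edge_graph) = hull_number edge_graph * hull_number edge_graph"
proof -
  have "hull_number edge_graph = card (pverts edge_graph)"
    by (rule hull_number_complete) (auto simp: edge_graph_def)
  moreover have "hull_number (edge_graph \<boxtimes> edge_graph) = card (pverts (edge_graph \<boxtimes> edge_graph))"
    by (rule hull_number_complete) (auto simp: edge_graph_def parcs_strong_product_iff)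
  ultimately show ?thesis by (simp add: card_cartesian_product)
qed

theorem theorem2:
  shows "(\<forall>(G :: 'a pair_pre_digraph) (H :: 'b pair_pre_digraph).
            nontrivial_connected_graph G \<and> nontrivial_connected_graph H \<longrightarrow>
              2 \<le> hull_number (G \<boxtimes> H) \<and>
              hull_number (G \<boxtimes> H) \<le> hull_number G * hull_number H)
       \<and> (\<exists>(G :: nat pair_pre_digraph) (H :: nat pair_pre_digraph).
            nontrivial_connected_graph G \<and> nontrivial_connected_graph H \<and>
              hull_number (G \<boxtimes> H) = 2)
       \<and> (\<exists>(G :: nat pair_pre_digraph) (H :: nat pair_pre_digraph).
            nontrivial_connected_graph G \<and> nontrivial_connected_graph H \<and>
              hull_number (G \<boxtimes> H) = hull_number G * hull_number H)"
  using two_le_hull_number_strong_product hull_number_strong_product_le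
    nontrivial_connected_edge_graph nontrivial_connected_square_graph
    hull_number_square_strong_edge hull_number_edge_strong_edge
  by blast

end
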